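(* Let $\mathcal{A}$ be an algebra over a field of characteristic zero and let $\mathcal{R}(\mathcal{A})$ be a nonempty subset of $\mathcal{A}\times\mathcal{A}$. (1) If $\mathcal{R}(\mathcal{A})$ is derivational for $L(\mathcal{A})$, then $\mathcal{R}(\mathcal{A})$ is higher derivational for $L(\mathcal{A})$. (2) If $\mathcal{R}(\mathcal{A})$ is Jordan derivational for $L(\mathcal{A})$, then $\mathcal{R}(\mathcal{A})$ is Jordan higher derivational for $L(\mathcal{A})$.
   Context: $L(\mathcal{A})$ is the set of all linear mappings from $\mathcal{A}$ to $\mathcal{A}$; $\mathbb{N}$ is the set of non-negative integers; $I_{\mathcal{A}}$ is the identity mapping on $\mathcal{A}$. A mapping $\delta\in L(\mathcal{A})$ is derivable on $\mathcal{R}(\mathcal{A})$ if $\delta(AB)=\delta(A)B+A\delta(B)$ for all $(A,B)\in\mathcal{R}(\mathcal{A})$, and Jordan derivable on $\mathcal{R}(\mathcal{A})$ if $\delta(AB+BA)=\delta(A)B+A\delta(B)+\delta(B)A+B\delta(A)$ for all $(A,B)\in\mathcal{R}(\mathcal{A})$. It is a derivation (resp. Jordan derivation) if the corresponding identity holds for all $A,B\in\mathcal{A}$. A sequence $\{d_i\}_{i\in\mathbb{N}}$ in $L(\mathcal{A})$ with $d_0=I_{\mathcal{A}}$ is higher derivable on $\mathcal{R}(\mathcal{A})$ if $d_n(AB)=\sum_{i+j=n}d_i(A)d_j(B)$ for all $n\in\mathbb{N}$ and all $(A,B)\in\mathcal{R}(\mathcal{A})$, and Jordan higher derivable on $\mathcal{R}(\mathcal{A})$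 if $d_n(AB+BA)=\sum_{i+j=n}(d_i(A)d_j(B)+d_i(B)d_j(A))$ for all $n\in\mathbb{N}$ and all $(A,B)\in\mathcal{R}(\mathcal{A})$. It is a higher derivation (resp. Jordan higher derivation) if the corresponding identity holds for all $n\in\mathbb{N}$ and all $A,B\in\mathcal{A}$. $\mathcal{R}(\mathcal{A})$ is derivational (resp. Jordan derivational) for $L(\mathcal{A})$ if every $\delta\in L(\mathcal{A})$ that is derivable (resp. Jordan derivable) on $\mathcal{R}(\mathcal{A})$ is a derivation (resp. Jordan derivation). $\mathcal{R}(\mathcal{A})$ is higher derivational (resp. Jordan higher derivational) for $L(\mathcal{A})$ if every sequence in $L(\mathcal{A})$ with $d_0=I_{\mathcal{A}}$ that is higher derivable (resp. Jordan higher derivable) on $\mathcal{R}(\mathcal{A})$ is a higher derivation (resp. Jordan higher derivation). *)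

theory Defs
  imports Complex_Main
begin

text \<open>
  Algebras are associative, but need be neither unital nor commutative: this is what the type
  class \<^class>\<open>ring\<close> provides. The locale \<open>algebra\<close> of HOL-Algebra requires
  commutativity of the multiplication and is therefore not used.
\<close>

locale algebra_over = vector_space scale
  for scale :: "'k::field \<Rightarrow> 'a::ring \<Rightarrow> 'a" +
  assumes scale_mult_left: "scale c x * y = scale c (x * y)"
    and scale_mult_right: "x * scale c y = scale c (x * y)"

definition linear_maps :: "('k::field \<Rightarrow> 'a::ring \<Rightarrow> 'a) \<Rightarrow> ('a \<Rightarrow> 'a) set" where
  "linear_maps scale = {f. Vector_Spaces.linear scale scale f}"

definition derivable_on ::
  "('k::field \<Rightarrow> 'a::ring \<Rightarrow> 'a) \<Rightarrow> ('a \<times> 'a) set \<Rightarrow> ('a \<Rightarrow> 'a) \<Rightarrow> bool" where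
  "derivable_on scale R \<delta> \<longleftrightarrow> \<delta> \<in> linear_maps scale \<and>
     (\<forall>(a, b) \<in> R. \<delta> (a * b) = \<delta> a * b + a * \<delta> b)"

definition jordan_derivable_on ::
  "('k::field \<Rightarrow> 'a::ring \<Rightarrow> 'a) \<Rightarrow> ('a \<times> 'a) set \<Rightarrow> ('a \<Rightarrow> 'a) \<Rightarrow> bool" where
  "jordan_derivable_on scale R \<delta> \<longleftrightarrow> \<delta> \<in> linear_maps scale \<and>
     (\<forall>(a, b) \<in> R. \<delta> (a * b + b * a) = \<delta> a * b + a * \<delta> b + \<delta> b * a + b * \<delta> a)"

definition derivation :: "('k::field \<Rightarrow> 'a::ring \<Rightarrow> 'a) \<Rightarrow> ('a \<Rightarrow> 'a) \<Rightarrow> bool" where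
  "derivation scale \<delta> \<longleftrightarrow> \<delta> \<in> linear_maps scale \<and>
     (\<forall>a b. \<delta> (a * b) = \<delta> a * b + a * \<delta> b)"

definition jordan_derivation :: "('k::field \<Rightarrow> 'a::ring \<Rightarrow> 'a) \<Rightarrow> ('a \<Rightarrow> 'a) \<Rightarrow> bool" where
  "jordan_derivation scale \<delta> \<longleftrightarrow> \<delta> \<in> linear_maps scale \<and>
     (\<forall>a b. \<delta> (a * b + b * a) = \<delta> a * b + a * \<delta> b + \<delta> b * a + b * \<delta> a)"

definition linear_map_sequences ::
  "('k::field \<Rightarrow> 'a::ring \<Rightarrow> 'a) \<Rightarrow> (nat \<Rightarrow> 'a \<Rightarrow> 'a) set" where
  "linear_map_sequences scale = {d. (\<forall>i. d i \<in> linear_maps scale) \<and> d 0 = id}"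

definition higher_derivable_on ::
  "('k::field \<Rightarrow> 'a::ring \<Rightarrow> 'a) \<Rightarrow> ('a \<times> 'a) set \<Rightarrow> (nat \<Rightarrow> 'a \<Rightarrow> 'a) \<Rightarrow> bool" where
  "higher_derivable_on scale R d \<longleftrightarrow> d \<in> linear_map_sequences scale \<and>
     (\<forall>n. \<forall>(a, b) \<in> R. d n (a * b) = (\<Sum>i\<le>n. d i a * d (n - i) b))"

definition jordan_higher_derivable_on ::
  "('k::field \<Rightarrow> 'a::ring \<Rightarrow> 'a) \<Rightarrow> ('a \<times> 'a) set \<Rightarrow> (nat \<Rightarrow> 'a \<Rightarrow> 'a) \<Rightarrow> bool" where
  "jordan_higher_derivable_on scale R d \<longleftrightarrow> d \<in> linear_map_sequences scale \<and>
     (\<forall>n. \<forall>(a, b) \<in> R. d n (a * b + b * a) =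
        (\<Sum>i\<le>n. d i a * d (n - i) b + d i b * d (n - i) a))"

definition higher_derivation ::
  "('k::field \<Rightarrow> 'a::ring \<Rightarrow> 'a) \<Rightarrow> (nat \<Rightarrow> 'a \<Rightarrow> 'a) \<Rightarrow> bool" where
  "higher_derivation scale d \<longleftrightarrow> d \<in> linear_map_sequences scale \<and>
     (\<forall>n a b. d n (a * b) = (\<Sum>i\<le>n. d i a * d (n - i) b))"

definition jordan_higher_derivation ::
  "('k::field \<Rightarrow> 'a::ring \<Rightarrow> 'a) \<Rightarrow> (nat \<Rightarrow> 'a \<Rightarrow> 'a) \<Rightarrow> bool" where
  "jordan_higher_derivation scale d \<longleftrightarrow> d \<in> linear_map_sequences scale \<and>
     (\<forall>n a b. d n (a * b + b * a) =
        (\<Sum>i\<le>n. d i a * d (n - i) b + d i b * d (n - i) a))"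

definition derivational ::
  "('k::field \<Rightarrow> 'a::ring \<Rightarrow> 'a) \<Rightarrow> ('a \<times> 'a) set \<Rightarrow> bool" where
  "derivational scale R \<longleftrightarrow>
     (\<forall>\<delta> \<in> linear_maps scale. derivable_on scale R \<delta> \<longrightarrow> derivation scale \<delta>)"

definition jordan_derivational ::
  "('k::field \<Rightarrow> 'a::ring \<Rightarrow> 'a) \<Rightarrow> ('a \<times> 'a) set \<Rightarrow> bool" where
  "jordan_derivational scale R \<longleftrightarrow>
     (\<forall>\<delta> \<in> linear_maps scale. jordan_derivable_on scale R \<delta> \<longrightarrow> jordan_derivation scale \<delta>)"

definition higher_derivational ::
  "('k::field \<Rightarrow> 'a::ring \<Rightarrow> 'a) \<Rightarrow> ('a \<times> 'a) set \<Rightarrow> bool" where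
  "higher_derivational scale R \<longleftrightarrow>
     (\<forall>d \<in> linear_map_sequences scale.
        higher_derivable_on scale R d \<longrightarrow> higher_derivation scale d)"

definition jordan_higher_derivational ::
  "('k::field \<Rightarrow> 'a::ring \<Rightarrow> 'a) \<Rightarrow> ('a \<times> 'a) set \<Rightarrow> bool" where
  "jordan_higher_derivational scale R \<longleftrightarrow>
     (\<forall>d \<in> linear_map_sequences scale.
        jordan_higher_derivable_on scale R d \<longrightarrow> jordan_higher_derivation scale d)"

end

theory Submission
  imports Defs
begin

text \<open>
  Write \<open>D(t) = \<Sum>\<^sub>n d\<^sub>n t\<^sup>n\<close> and let \<open>\<Delta>(t) = \<Sum>\<^sub>n \<delta>\<^sub>n t\<^sup>n\<close> be defined by
  \<open>t D'(t) = \<Delta>(t) D(t)\<close>, that is, \<open>n d\<^sub>n = \<Sum>\<^sub>k \<delta>\<^sub>k d\<^sub>n\<^sub>-\<^sub>k\<close>. If \<open>d\<close> is multiplicative on a pair \<open>(a, b)\<close> and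
  \<open>\<delta>\<^sub>k\<close> is a derivation for all \<open>k < n\<close>, then comparing coefficients shows that \<open>\<delta>\<^sub>n\<close> is derivable at
  \<open>(a, b)\<close>; so by induction every \<open>\<delta>\<^sub>n\<close> is a derivation. Conversely, if all \<open>\<delta>\<^sub>n\<close> are derivations,
  the same comparison and division by \<open>n\<close> show that \<open>d\<close> is a higher derivation. The argument uses
  only that the product is bilinear, so it applies both to \<open>a b\<close> and to \<open>a b + b a\<close>.
\<close>

text \<open>This solves \<open>n d\<^sub>n = \<Sum>\<^sub>k \<delta>\<^sub>k
  d\<^sub>n\<^sub>-\<^sub>k\<close> for the term \<open>k = n\<close>, which is
  \<open>\<delta>\<^sub>n\<close> itself once \<open>d 0 = id\<close>; \<open>scale_d\<close>
  recovers the equation.\<close>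

fun log_deriv ::
  "('k::field_char_0 \<Rightarrow> 'a::ab_group_add \<Rightarrow> 'a) \<Rightarrow> (nat \<Rightarrow> 'a \<Rightarrow> 'a) \<Rightarrow> nat \<Rightarrow> 'a \<Rightarrow> 'a" where
  "log_deriv scale d n x =
     scale (of_nat n) (d n x) - (\<Sum>k<n. log_deriv scale d k (d (n - k) x))"

declare log_deriv.simps [simp del]

text \<open>Both sides run over the triples \<open>(k, i, j)\<close> with
  \<open>k + i + j = n\<close>; the left one groups them by \<open>m = k + i\<close>.\<close>

lemma sum_diagonal_to_row:
  fixes f :: "nat \<Rightarrow> nat \<Rightarrow> nat \<Rightarrow> 'a::comm_monoid_add"
  shows "(\<Sum>m\<le>n. \<Sum>k\<le>m. f k (m - k) (n - m)) = (\<Sum>k\<le>n. \<Sum>i\<le>n - k. f k i (n - k - i))"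
  unfolding sum.Sigma[OF finite_atMost ballI[OF finite_atMost]]
  by (rule sum.reindex_bij_witness[where i = "\<lambda>(k, i). (k + i, k)" and j = "\<lambda>(m, k). (k, m - k)"])
    auto

text \<open>The same triples, grouped on the left by their second entry instead.\<close>

lemma sum_swap_triangle:
  fixes f :: "nat \<Rightarrow> nat \<Rightarrow> nat \<Rightarrow> 'a::comm_monoid_add"
  shows "(\<Sum>m\<le>n. \<Sum>k\<le>n - m. f k m (n - m - k)) = (\<Sum>k\<le>n. \<Sum>i\<le>n - k. f k i (n - k - i))"
  unfolding sum.Sigma[OF finite_atMost ballI[OF finite_atMost]]
  by (rule sum.reindex_bij_witness[where i = "\<lambda>(k, i). (i, k)" and j = "\<lambda>(m, k). (k, m)"])
    (auto simp: diff_commute add.commute)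

locale bilinear_product = vector_space scale
  for scale :: "'k::field_char_0 \<Rightarrow> 'a::ab_group_add \<Rightarrow> 'a" +
  fixes P :: "'a \<Rightarrow> 'a \<Rightarrow> 'a"
  assumes linear_left: "Vector_Spaces.linear scale scale (\<lambda>x. P x y)"
    and linear_right: "Vector_Spaces.linear scale scale (P x)"
begin

lemmas P_sum_left = module_hom.sum[OF linear_left[unfolded linear_iff_module_hom]]
  and P_sum_right = module_hom.sum[OF linear_right[unfolded linear_iff_module_hom]]
  and P_scale_left = module_hom.scale[OF linear_left[unfolded linear_iff_module_hom]]
  and P_scale_right = module_hom.scale[OF linear_right[unfolded linear_iff_module_hom]]

abbreviation derivable_at :: "('a \<Rightarrow> 'a) \<Rightarrow> 'a \<Rightarrow> 'a \<Rightarrow> bool" where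
  "derivable_at \<delta> x y \<equiv> \<delta> (P x y) = P (\<delta> x) y + P x (\<delta> y)"

abbreviation higher_derivable_at :: "(nat \<Rightarrow> 'a \<Rightarrow> 'a) \<Rightarrow> nat \<Rightarrow> 'a \<Rightarrow> 'a \<Rightarrow> bool" where
  "higher_derivable_at d n x y \<equiv> d n (P x y) = (\<Sum>i\<le>n. P (d i x) (d (n - i) y))"

end

locale linear_sequence = bilinear_product scale P
  for scale :: "'k::field_char_0 \<Rightarrow> 'a::ab_group_add \<Rightarrow> 'a" and P +
  fixes d :: "nat \<Rightarrow> 'a \<Rightarrow> 'a"
  assumes linear_d: "Vector_Spaces.linear scale scale (d n)"
    and d_0 [simp]: "d 0 = id"
begin

abbreviation "\<delta> \<equiv> log_deriv scale d"

lemma linear_log_deriv: "Vector_Spaces.linear scale scale (\<delta> n)"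
proof (induction n rule: less_induct)
  case (less n)
  interpret vector_space_pair scale scale ..
  have "Vector_Spaces.linear scale scale (\<lambda>x. \<delta> k (d (n - k) x))" if "k < n" for k
    using Vector_Spaces.linear_compose[OF linear_d less[OF that]] by (simp add: comp_def)
  then have "Vector_Spaces.linear scale scale (\<lambda>x. \<Sum>k<n. \<delta> k (d (n - k) x))"
    by (intro linear_compose_sum) auto
  then have "Vector_Spaces.linear scale scale
      (\<lambda>x. scale (of_nat n) (d n x) - (\<Sum>k<n. \<delta> k (d (n - k) x)))"
    by (intro linear_compose_sub linear_compose_scale_right linear_d)
  then show ?case
    by (subst log_deriv.simps[abs_def]) simp
qed

lemmas log_deriv_sum = module_hom.sum[OF linear_log_deriv[unfolded linear_iff_module_hom]]

lemma scale_d: "scale (of_nat n) (d n x) = (\<Sum>k\<le>n. \<delta> k (d (n - k) x))"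
  by (simp add: log_deriv.simps[of scale d n x] lessThan_Suc_atMost[symmetric])

lemma log_deriv_0: "\<delta> 0 x = 0"
  by (simp add: log_deriv.simps[of _ _ 0])

text \<open>This is the Leibniz rule for the operator \<open>t d/dt\<close>. The weight
  \<open>n\<close> splits as \<open>i + (n - i)\<close>, and each share is absorbed by its own
  factor through \<open>scale_d\<close>. Nothing is assumed here about derivability.\<close>

lemma scale_convolution:
  "scale (of_nat n) (\<Sum>i\<le>n. P (d i x) (d (n - i) y)) =
     (\<Sum>k\<le>n. \<Sum>i\<le>n - k. P (\<delta> k (d i x)) (d (n - k - i) y) + P (d i x) (\<delta> k (d (n - k - i) y)))"
proof -
  have "scale (of_nat n) (P (d i x) (d (n - i) y)) =
      (\<Sum>k\<le>i. P (\<delta> k (d (i - k) x)) (d (n - i) y)) +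
      (\<Sum>k\<le>n - i. P (d i x) (\<delta> k (d (n - i - k) y)))"
    if "i \<le> n" for i
  proof -
    have "scale (of_nat n) z = scale (of_nat i) z + scale (of_nat (n - i)) z" for z
      by (simp only: scale_left_distrib[symmetric] of_nat_add[symmetric] le_add_diff_inverse[OF that])
    then have "scale (of_nat n) (P (d i x) (d (n - i) y)) =
        P (scale (of_nat i) (d i x)) (d (n - i) y) +
        P (d i x) (scale (of_nat (n - i)) (d (n - i) y))"
      by (simp only: P_scale_left P_scale_right)
    then show ?thesis
      by (simp only: scale_d P_sum_left P_sum_right)
  qed
  then have "scale (of_nat n) (\<Sum>i\<le>n. P (d i x) (d (n - i) y)) =
      (\<Sum>m\<le>n. \<Sum>k\<le>m. P (\<delta> k (d (m - k) x)) (d (n - m) y)) +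
      (\<Sum>m\<le>n. \<Sum>k\<le>n - m. P (d m x) (\<delta> k (d (n - m - k) y)))"
    by (simp add: scale_sum_right flip: sum.distrib)
  also have "\<dots> = (\<Sum>k\<le>n. \<Sum>i\<le>n - k. P (\<delta> k (d i x)) (d (n - k - i) y)) +
      (\<Sum>k\<le>n. \<Sum>i\<le>n - k. P (d i x) (\<delta> k (d (n - k - i) y)))"
    by (simp only: sum_diagonal_to_row[of "\<lambda>k i j. P (\<delta> k (d i x)) (d j y)"]
        sum_swap_triangle[of "\<lambda>k i j. P (d i x) (\<delta> k (d j y))"])
  finally show ?thesis
    by (simp add: sum.distrib)
qed

text \<open>With \<open>m = n - k\<close> the right side is exactly the \<open>k\<close>-th summand
  of \<open>scale_convolution\<close>.\<close>

lemma log_deriv_convolution: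
  assumes "higher_derivable_at d m a b" and "\<And>x y. derivable_at (\<delta> k) x y"
  shows "\<delta> k (d m (P a b)) =
    (\<Sum>i\<le>m. P (\<delta> k (d i a)) (d (m - i) b) + P (d i a) (\<delta> k (d (m - i) b)))"
  unfolding assms(1) log_deriv_sum by (simp only: assms(2))

text \<open>\<open>n d\<^sub>n (P a b)\<close> is expanded by \<open>scale_d\<close> and by
  \<open>scale_convolution\<close>. The summands with \<open>k < n\<close> agree and cancel, which
  leaves those with \<open>k = n\<close>.\<close>

lemma log_deriv_derivable_at:
  assumes higher: "\<And>m. m \<le> n \<Longrightarrow> higher_derivable_at d m a b"
    and derivable: "\<And>k x y. k < n \<Longrightarrow> derivable_at (\<delta> k) x y"
  shows "derivable_at (\<delta> n) a b"
proof -
  let ?S = "\<lambda>k. \<Sum>i\<le>n - k. P (\<delta> k (d i a)) (d (n - k - i) b) + P (d i a) (\<delta> k (d (n - k - i) b))"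
  have "\<delta> k (d (n - k) (P a b)) = ?S k" if "k < n" for k
    by (rule log_deriv_convolution[OF higher derivable[OF that]]) simp
  then have "scale (of_nat n) (d n (P a b)) = (\<Sum>k<n. ?S k) + \<delta> n (P a b)"
    by (simp add: scale_d lessThan_Suc_atMost[symmetric])
  moreover have "scale (of_nat n) (d n (P a b)) = (\<Sum>k<n. ?S k) + ?S n"
    unfolding higher[OF order_refl] scale_convolution by (simp only: lessThan_Suc_atMost[symmetric] sum.lessThan_Suc)
  \<comment> \<open>The inner sum \<open>?S n\<close> has only the index \<open>i = 0\<close>, where
    \<open>d 0 = id\<close>.\<close>
  ultimately show ?thesis
    by simp
qed

lemma higher_derivable_at_if_log_deriv:
  assumes "\<And>k x y. derivable_at (\<delta> k) x y"
  shows "higher_derivable_at d n a b"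
proof (induction n rule: less_induct)
  case (less n)
  show ?case
  proof (cases "n = 0")
    case False
    let ?S = "\<lambda>k. \<Sum>i\<le>n - k. P (\<delta> k (d i a)) (d (n - k - i) b) + P (d i a) (\<delta> k (d (n - k - i) b))"
    have "\<delta> k (d (n - k) (P a b)) = ?S k" for k
    \<comment> \<open>For \<open>k = 0\<close> the convolution lemma would need the claim at
      \<open>n\<close> itself, which the induction does not supply; but
      \<open>\<delta> 0 = 0\<close> makes both sides vanish.\<close>
    proof (cases "k = 0")
      case True
      have "P 0 y = 0" "P y 0 = 0" for y
        using P_scale_left[of 0 0 y] P_scale_right[of y 0 0] by simp_all
      then show ?thesis
        using True by (simp add: log_deriv_0)
    next
      case False
      then show ?thesis
        using \<open>n \<noteq> 0\<close> by (intro log_deriv_convolution assms less) simp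
    qed
    then have "scale (of_nat n) (d n (P a b)) =
        scale (of_nat n) (\<Sum>i\<le>n. P (d i a) (d (n - i) b))"
      unfolding scale_convolution by (simp add: scale_d)
    \<comment> \<open>In characteristic zero the nonzero \<open>n\<close> can be cancelled.\<close>
    then show ?thesis
      using False by simp
  qed simp
qed

theorem higher_derivable_if_derivational:
  assumes derivational: "\<And>f x y. \<lbrakk>Vector_Spaces.linear scale scale f;
        \<And>a b. (a, b) \<in> R \<Longrightarrow> derivable_at f a b\<rbrakk> \<Longrightarrow> derivable_at f x y"
    and higher: "\<And>m a b. (a, b) \<in> R \<Longrightarrow> higher_derivable_at d m a b"
  shows "higher_derivable_at d n x y"
proof (rule higher_derivable_at_if_log_deriv)
  show "derivable_at (\<delta> k) x y" for k x y
  \<comment> \<open>The induction must give derivability at all pairs: the lower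
    \<open>\<delta> j\<close> are applied to products of \<open>d i a\<close> and
    \<open>d l b\<close>, and these pairs may lie outside \<open>R\<close>.\<close>
  proof (induction k arbitrary: x y rule: less_induct)
    case (less k)
    show ?case
    proof (rule derivational[OF linear_log_deriv])
      show "derivable_at (\<delta> k) a b" if "(a, b) \<in> R" for a b
        by (rule log_deriv_derivable_at[OF higher[OF that] less])
    qed
  qed
qed

end

lemma (in algebra_over) linear_mult_left: "Vector_Spaces.linear scale scale (\<lambda>x. x * y)"
  and linear_mult_right: "Vector_Spaces.linear scale scale ((*) x)"
  by (unfold Vector_Spaces.linear_iff)
    (simp_all add: vector_space_axioms scale_mult_left scale_mult_right distrib_left distrib_right)

lemma (in algebra_over) linear_jordan_product_left:
  "Vector_Spaces.linear scale scale (\<lambda>x. x * y + y * x)"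
  by (unfold Vector_Spaces.linear_iff)
    (simp add: vector_space_axioms scale_mult_left scale_mult_right scale_right_distrib
      distrib_left distrib_right)

lemma (in algebra_over) linear_jordan_product_right:
  "Vector_Spaces.linear scale scale (\<lambda>y. x * y + y * x)"
  using linear_jordan_product_left[of x] by (simp add: add.commute)

theorem theorem3p3:
  fixes scale :: "'k::field_char_0 \<Rightarrow> 'a::ring \<Rightarrow> 'a"
    and R :: "('a \<times> 'a) set"
  assumes "algebra_over scale" and "R \<noteq> {}"
  shows "(derivational scale R \<longrightarrow> higher_derivational scale R) \<and>
         (jordan_derivational scale R \<longrightarrow> jordan_higher_derivational scale R)"
proof (intro conjI impI)
  interpret algebra_over scale by fact
  show "higher_derivational scale R" if derivational: "derivational scale R"
    unfolding higher_derivational_def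
  proof (intro ballI impI)
    fix d
    assume d: "d \<in> linear_map_sequences scale" and R: "higher_derivable_on scale R d"
    have "linear_sequence scale (*) d"
    proof (intro linear_sequence.intro bilinear_product.intro bilinear_product_axioms.intro
        linear_sequence_axioms.intro vector_space_axioms linear_mult_left linear_mult_right)
      show "Vector_Spaces.linear scale scale (d n)" "d 0 = id" for n
        using d by (simp_all add: linear_map_sequences_def linear_maps_def)
    qed
    note derivable = linear_sequence.higher_derivable_if_derivational[OF this, of R]
    have "d n (x * y) = (\<Sum>i\<le>n. d i x * d (n - i) y)" for n x y
    proof (rule derivable)
      show "f (x * y) = f x * y + x * f y"
        if f: "Vector_Spaces.linear scale scale f"
          and f_R: "\<And>a b. (a, b) \<in> R \<Longrightarrow> f (a * b) = f a * b + a * f b" for f x y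
      proof -
        have "derivable_on scale R f"
          using f f_R unfolding derivable_on_def linear_maps_def by blast
        then have "derivation scale f"
          using derivational unfolding derivational_def derivable_on_def by blast
        then show ?thesis
          unfolding derivation_def by blast
      qed
      show "d m (a * b) = (\<Sum>i\<le>m. d i a * d (m - i) b)" if "(a, b) \<in> R" for m a b
        using R that unfolding higher_derivable_on_def by blast
    qed
    then show "higher_derivation scale d"
      using d by (simp add: higher_derivation_def)
  qed
  show "jordan_higher_derivational scale R" if derivational: "jordan_derivational scale R"
    unfolding jordan_higher_derivational_def
  proof (intro ballI impI)
    fix d
    assume d: "d \<in> linear_map_sequences scale" and R: "jordan_higher_derivable_on scale R d"
    let ?P = "\<lambda>x y. x * y + y * x"
    have "linear_sequence scale ?P d"
    proof (intro linear_sequence.intro bilinear_product.intro bilinear_product_axioms.intro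
        linear_sequence_axioms.intro vector_space_axioms
        linear_jordan_product_left linear_jordan_product_right)
      show "Vector_Spaces.linear scale scale (d n)" "d 0 = id" for n
        using d by (simp_all add: linear_map_sequences_def linear_maps_def)
    qed
    note derivable = linear_sequence.higher_derivable_if_derivational[OF this, of R]
    \<comment> \<open>The Jordan sum becomes a convolution for \<open>?P\<close> after reversing
      \<open>i\<close> to \<open>n - i\<close> in its second half.\<close>
    have convolution: "(\<Sum>i\<le>n. d i x * d (n - i) y + d i y * d (n - i) x) =
        (\<Sum>i\<le>n. ?P (d i x) (d (n - i) y))" for n x y
      using sum.nat_diff_reindex[of "\<lambda>i. d i y * d (n - i) x" "Suc n"]
      by (simp add: sum.distrib lessThan_Suc_atMost)
    have "d n (?P x y) = (\<Sum>i\<le>n. ?P (d i x) (d (n - i) y))" for n x y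
    proof (rule derivable)
      show "f (?P x y) = ?P (f x) y + ?P x (f y)"
        if f: "Vector_Spaces.linear scale scale f"
          and f_R: "\<And>a b. (a, b) \<in> R \<Longrightarrow> f (?P a b) = ?P (f a) b + ?P a (f b)" for f x y
      proof -
        \<comment> \<open>Up to the order of the summands, the Jordan identity is the ordinary
          Leibniz rule for \<open>?P\<close>.\<close>
        have P: "?P (f a) b + ?P a (f b) = f a * b + a * f b + f b * a + b * f a" for a b
          by (simp add: algebra_simps)
        have "jordan_derivable_on scale R f"
          using f f_R[unfolded P] unfolding jordan_derivable_on_def linear_maps_def by blast
        then have "jordan_derivation scale f"
          using derivational unfolding jordan_derivational_def jordan_derivable_on_def by blast
        then show ?thesis
          unfolding jordan_derivation_def P by blast
      qed
      show "d m (?P a b) = (\<Sum>i\<le>m. ?P (d i a) (d (m - i) b))" if "(a, b) \<in> R" for m a b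
        using R that unfolding jordan_higher_derivable_on_def convolution by blast
    qed
    then show "jordan_higher_derivation scale d"
      using d by (simp add: jordan_higher_derivation_def convolution)
  qed
qed

end
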